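(* Let $n\ge1$, let $p_1,\dots,p_n$ be distinct primes and $m_1,\dots,m_n\ge 0$ integers. Let $f$ be a multiplicative arithmetic function with $f\in\mathbb{B}\{G_1(N);G_2(N)\}$, where $G_1(N)=N^{a_1}(\log N)^{b_1}$ and $G_2(N)=N^{-a_2}(\log N)^{-b_2}$, and where the exponents satisfy: either $a_1>0$ and $-\infty<b_1<\infty$, or $a_1=0$ and $0\le b_1<\infty$; and either $a_2>0$ and $-\infty<b_2<\infty$, or $a_2=0$ and $0<b_2<\infty$. Suppose there exist real numbers $\mathcal{K}>0$ and $\gamma<a_1$ and an integer $r_*\ge 0$ such that $|L_r(f;p_i^{m_i})|\le \mathcal{K}p_i^{\gamma r}$ for all $r\ge r_*$ and all $i=1,\dots,n$. Then the limit $R_\infty\left(f;\prod_{i=1}^np_i^{m_i}\right)$ exists and $$R_{\infty}\left(f;\prod_{i=1}^np_i^{m_i}\right)=\prod_{i=1}^n\left(\sum_{r_i=0}^{\infty}\frac{L_{r_i}(f;p_i^{m_i})}{p_i^{a_1r_i}}\right).$$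
   Context: An arithmetic function $f:\mathbb{Z}_{>0}\to\mathbb{R}$ is multiplicative if $f(1)=1$ and $f(k_1k_2)=f(k_1)f(k_2)$ whenever $\gcd(k_1,k_2)=1$. For a positive integer $q$ put $F\{f;N,q\}=\sum_{k\le N}f(qk)$ (sum over positive integers $k\le N$); in particular $F\{f;N,1\}=\sum_{k\le N}f(k)$. Universality class: for positive functions $G_1,G_2$ (defined for large $N$) with $G_1$ nondecreasing and $G_2(N)\to0$, $f\in\mathbb{B}\{G_1(N);G_2(N)\}$ means that there are constants $0<\mathcal{F},\mathcal{C}<\infty$ such that $\frac{F\{f;N,1\}}{\mathcal{F}G_1(N)}\to1$ as $N\to\infty$ and $\left|\frac{F\{f;N,1\}}{\mathcal{F}G_1(N)}-1\right|<\mathcal{C}\,G_2(N)$ for all sufficiently large $N$. Characteristic functions, for a prime $p$ and integer $m\ge0$: $L_0(f;p^m)=f(p^m)$ and, for $r\ge1$, $L_r(f;p^m)=f(p^{m+r})-\sum_{j=0}^{r-1}L_j(f;p^m)f(p^{r-j})$. Renormalization function: for a positive integer $q$, $R_\infty(f;q)=\lim_{N\to\infty}\frac{F\{f;N,q\}}{F\{f;N,1\}}$. *)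

theory Defs
  imports Complex_Main "HOL-Computational_Algebra.Primes"
begin

text \<open>
  Arithmetic functions, defined on the positive integers, are rendered as functions on
  \<^typ>\<open>nat\<close>; nothing below depends on their value at 0.
\<close>

definition multiplicative :: "(nat \<Rightarrow> real) \<Rightarrow> bool" where
  "multiplicative f \<longleftrightarrow>
     f 1 = 1 \<and> (\<forall>k\<^sub>1>0. \<forall>k\<^sub>2>0. coprime k\<^sub>1 k\<^sub>2 \<longrightarrow> f (k\<^sub>1 * k\<^sub>2) = f k\<^sub>1 * f k\<^sub>2)"

definition summatory :: "(nat \<Rightarrow> real) \<Rightarrow> nat \<Rightarrow> nat \<Rightarrow> real" where
  "summatory f N q = (\<Sum>k=1..N. f (q * k))"

text \<open>
  The functions \<open>G\<^sub>1\<close>, \<open>G\<^sub>2\<close> matter for large arguments only, so positivity and monotonicity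
  are required from some point on. For example, \<open>N powr a * ln N powr b\<close> with \<open>a > 0\<close> and
  \<open>b < 0\<close> vanishes at 1 and is decreasing on an initial range.
\<close>

definition universality_class ::
    "(nat \<Rightarrow> real) \<Rightarrow> (nat \<Rightarrow> real) \<Rightarrow> (nat \<Rightarrow> real) set" where
  "universality_class G\<^sub>1 G\<^sub>2 = {f.
     (\<forall>\<^sub>F N in sequentially. G\<^sub>1 N > 0 \<and> G\<^sub>2 N > 0) \<and>
     (\<exists>N\<^sub>0. mono_on {N\<^sub>0..} G\<^sub>1) \<and>
     G\<^sub>2 \<longlonglongrightarrow> 0 \<and>
     (\<exists>F>0. \<exists>C>0.
        (\<lambda>N. summatory f N 1 / (F * G\<^sub>1 N)) \<longlonglongrightarrow> 1 \<and>
        (\<forall>\<^sub>F N in sequentially. \<bar>summatory f N 1 / (F * G\<^sub>1 N) - 1\<bar> < C * G\<^sub>2 N))}"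

text \<open>
  \<open>char_fun f p m r\<close> is the characteristic function \<open>L\<^sub>r(f; p\<^sup>m)\<close>; the prime power is passed
  as the pair of its base and exponent.
\<close>

fun char_fun :: "(nat \<Rightarrow> real) \<Rightarrow> nat \<Rightarrow> nat \<Rightarrow> nat \<Rightarrow> real" where
  "char_fun f p m 0 = f (p ^ m)"
| "char_fun f p m (Suc r) =
     f (p ^ (m + Suc r)) - (\<Sum>j<Suc r. char_fun f p m j * f (p ^ (Suc r - j)))"

definition renorm_ratio :: "(nat \<Rightarrow> real) \<Rightarrow> nat \<Rightarrow> nat \<Rightarrow> real" where
  "renorm_ratio f q N = summatory f N q / summatory f N 1"

text \<open>Meaningful only if the sequence of ratios converges.\<close>

definition renorm_limit :: "(nat \<Rightarrow> real) \<Rightarrow> nat \<Rightarrow> real" where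
  "renorm_limit f q = lim (renorm_ratio f q)"

end

theory Submission
  imports Defs "HOL-Real_Asymp.Real_Asymp" "HOL-Analysis.Uniform_Limit"
begin

text \<open>
  The numbers \<open>L\<^sub>r(f; p\<^sup>m)\<close> are the coefficients of the quotient of the generating functions of
  \<open>f(p\<^sup>m\<^sup>+\<^sup>s)\<close> and \<open>f(p\<^sup>s)\<close>. For \<open>q\<close> coprime to \<open>p\<close> this turns into the finite expansion
  \<open>F(N, q p\<^sup>m) = \<Sum>\<^sub>r L\<^sub>r(f; p\<^sup>m) F(N div p\<^sup>r, q)\<close>. After division by \<open>F(N, 1)\<close> the \<open>r\<close>-th term
  tends to \<open>L\<^sub>r p\<^bsup>-a\<^sub>1r\<^esup> R(q)\<close> because \<open>N\<^bsup>a\<^sub>1\<^esup> (log N)\<^bsup>b\<^sub>1\<^esup>\<close> varies regularly with index \<open>a\<^sub>1\<close>.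
  For an exponent \<open>\<delta>\<close> between \<open>\<gamma>\<close> and \<open>a\<^sub>1\<close> it is dominated by a multiple of
  \<open>p\<^bsup>(\<gamma>-\<delta>)r\<^esup>\<close>, so Tannery's theorem allows passing to the limit term by term, and the
  theorem follows by adding one prime at a time.
\<close>

section \<open>Expansion of the summatory function along the powers of one prime\<close>

lemma char_fun_convolution:
  assumes "f 1 = 1"
  shows "f (p ^ (m + s)) = (\<Sum>j\<le>s. char_fun f p m j * f (p ^ (s - j)))"
proof (cases s)
  case 0
  then show ?thesis using assms by simp
next
  case (Suc r)
  have "(\<Sum>j\<le>Suc r. char_fun f p m j * f (p ^ (Suc r - j))) =
        (\<Sum>j<Suc r. char_fun f p m j * f (p ^ (Suc r - j))) + char_fun f p m (Suc r)"
    using assms by (simp flip: lessThan_Suc_atMost del: char_fun.simps)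
  then show ?thesis unfolding Suc by simp
qed

text \<open>Split \<open>k = p ^ s * u\<close> with \<open>u\<close> prime to \<open>p\<close>, so
  that \<open>f (p ^ (m + s))\<close> separates from \<open>f (q * u)\<close>. Expand the former by
  \<open>char_fun_convolution\<close>; each \<open>f (p ^ (s - r))\<close> then recombines with
  \<open>f (q * u)\<close> because \<open>p\<close> divides neither \<open>q\<close> nor
  \<open>u\<close>. The range \<open>r \<le> N\<close> does not depend on \<open>k\<close>, which
  prepares the interchange with the sum over \<open>k\<close>.\<close>

lemma multiplicative_prime_power_expansion:
  assumes "multiplicative f" "prime p" "q > 0" "coprime q p" "k > 0" "k \<le> N"
  shows "f (q * p ^ m * k) =
           (\<Sum>r | r \<le> N \<and> p ^ r dvd k. char_fun f p m r * f (q * (k div p ^ r)))"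
proof -
  have f1: "f 1 = 1"
    and mult: "\<And>x y. x > 0 \<Longrightarrow> y > 0 \<Longrightarrow> coprime x y \<Longrightarrow> f (x * y) = f x * f y"
    using assms(1) by (auto simp: multiplicative_def)
  have p: "p > 1" using assms(2) by (rule prime_gt_1_nat)
  obtain u where k: "k = p ^ multiplicity p k * u" and pu: "\<not> p dvd u"
    using multiplicity_decompose'[of k p] assms(2,5) by (metis not_prime_unit less_not_refl)
  define s where "s = multiplicity p k"
  have ks: "k = p ^ s * u" using k by (simp add: s_def)
  have u: "u > 0" using ks assms(5) by (cases u) auto
  have cop: "coprime (p ^ i) (q * u)" for i
    using assms(2,4) pu by (auto simp: coprime_commute prime_imp_coprime)
  \<comment> \<open>This gives \<open>s \<le> N\<close>, so the cut-off \<open>r \<le> N\<close>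
    removes no divisor \<open>p ^ r\<close> of \<open>k\<close>.\<close>
  have "s < p ^ s" using p by (simp add: power_gt_expt)
  also have "\<dots> \<le> k" using ks u by simp
  finally have "s \<le> N" using assms(6) by simp
  then have set_eq: "{r. r \<le> N \<and> p ^ r dvd k} = {..s}"
    using assms(2,5) p by (auto simp: s_def power_dvd_iff_le_multiplicity)
  have "f (q * p ^ m * k) = f (p ^ (m + s) * (q * u))"
    by (simp add: ks power_add mult_ac)
  also have "\<dots> = f (p ^ (m + s)) * f (q * u)"
    using p u assms(3) cop by (intro mult) auto
  also have "\<dots> = (\<Sum>r\<le>s. char_fun f p m r * (f (p ^ (s - r)) * f (q * u)))"
    by (simp add: char_fun_convolution[of f, OF f1] sum_distrib_right mult.assoc)
  also have "\<dots> = (\<Sum>r\<le>s. char_fun f p m r * f (q * (k div p ^ r)))"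
  proof (rule sum.cong)
    fix r assume "r \<in> {..s}"
    then have "p ^ s = p ^ r * p ^ (s - r)" by (simp flip: power_add)
    then have "k div p ^ r = p ^ (s - r) * u" using p by (simp add: ks)
    then have "q * (k div p ^ r) = p ^ (s - r) * (q * u)" by (simp add: mult_ac)
    moreover have "f (p ^ (s - r) * (q * u)) = f (p ^ (s - r)) * f (q * u)"
      using p u assms(3) cop by (intro mult) auto
    ultimately show "char_fun f p m r * (f (p ^ (s - r)) * f (q * u)) =
        char_fun f p m r * f (q * (k div p ^ r))" by (simp only:)
  qed simp
  finally show ?thesis unfolding set_eq .
qed

lemma sum_multiples:
  fixes g :: "nat \<Rightarrow> real"
  assumes "d > 0"
  shows "(\<Sum>k | k \<in> {1..N} \<and> d dvd k. g (k div d)) = (\<Sum>i=1..N div d. g i)"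
proof (rule sum.reindex_bij_witness[where i = "\<lambda>i. d * i" and j = "\<lambda>k. k div d"])
  fix i assume "i \<in> {1..N div d}"
  then have i: "1 \<le> i" "i \<le> N div d" by auto
  have "d * i \<le> d * (N div d)" using i by simp
  also have "\<dots> \<le> N" by simp
  finally show "d * i \<in> {k. k \<in> {1..N} \<and> d dvd k}" using i assms by simp
qed (use assms in \<open>auto simp: div_le_mono\<close>)

lemma summatory_prime_power:
  assumes "multiplicative f" "prime p" "q > 0" "coprime q p"
  shows "summatory f N (q * p ^ m) =
           (\<Sum>r\<le>N. char_fun f p m r * summatory f (N div p ^ r) q)"
proof -
  have "summatory f N (q * p ^ m) =
      (\<Sum>k=1..N. \<Sum>r | r \<in> {..N} \<and> p ^ r dvd k. char_fun f p m r * f (q * (k div p ^ r)))"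
    unfolding summatory_def
    by (intro sum.cong) (auto simp: multiplicative_prime_power_expansion[OF assms])
  also have "\<dots> =
      (\<Sum>r\<le>N. \<Sum>k | k \<in> {1..N} \<and> p ^ r dvd k. char_fun f p m r * f (q * (k div p ^ r)))"
    by (rule sum.swap_restrict) auto
  also have "\<dots> = (\<Sum>r\<le>N. char_fun f p m r * summatory f (N div p ^ r) q)"
  proof (rule sum.cong)
    fix r
    have "(\<Sum>k | k \<in> {1..N} \<and> p ^ r dvd k. f (q * (k div p ^ r))) = summatory f (N div p ^ r) q"
      unfolding summatory_def
      using prime_gt_0_nat[OF assms(2)] by (intro sum_multiples) simp
    then show "(\<Sum>k | k \<in> {1..N} \<and> p ^ r dvd k. char_fun f p m r * f (q * (k div p ^ r))) =
        char_fun f p m r * summatory f (N div p ^ r) q"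
      by (simp flip: sum_distrib_left)
  qed simp
  finally show ?thesis .
qed

section \<open>Regular variation and eventual monotonicity of power-log functions\<close>

abbreviation (input) power_log :: "real \<Rightarrow> real \<Rightarrow> nat \<Rightarrow> real" where
  "power_log a b N \<equiv> real N powr a * ln (real N) powr b"

lemma power_log_pos: "N \<ge> 2 \<Longrightarrow> power_log a b N > 0"
  by simp

lemma filterlim_div_const:
  assumes "c > 0"
  shows "filterlim (\<lambda>N::nat. N div c) at_top at_top"
  unfolding filterlim_at_top
proof
  fix Z
  have "Z \<le> N div c" if "N \<ge> Z * c" for N
    using div_le_mono[OF that, of c] assms by simp
  then show "\<forall>\<^sub>F N in sequentially. Z \<le> N div c"
    by (auto simp: eventually_at_top_linorder)
qed

lemma power_log_regularly_varying:
  assumes "c > 0"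
  shows "(\<lambda>N. power_log a b (N div c) / power_log a b N) \<longlonglongrightarrow> real c powr (- a)"
proof -
  note div = filterlim_div_const[OF assms]
  have big: "\<forall>\<^sub>F N in sequentially. N div c \<ge> 2"
    using div by (simp add: filterlim_at_top)
  have ratio: "(\<lambda>N. real (N div c) / real N) \<longlonglongrightarrow> 1 / real c"
  proof (rule real_tendsto_sandwich)
    \<comment> \<open>Rounding down in \<open>N div c\<close> costs at most 1, hence at most
      \<open>1 / N\<close> after division by \<open>N\<close>.\<close>
    show "(\<lambda>N. 1 / real c - 1 / real N) \<longlonglongrightarrow> 1 / real c"
      by real_asymp
    show "\<forall>\<^sub>F N in sequentially. 1 / real c - 1 / real N \<le> real (N div c) / real N"
      using eventually_gt_at_top[of 0]
    proof eventually_elim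
      case (elim N)
      have "real N / real c \<le> real (N div c) + 1"
        using floor_divide_of_nat_eq[of N c, where ?'a = real] by linarith
      then have "(real N / real c - 1) / real N \<le> real (N div c) / real N"
        by (intro divide_right_mono) auto
      then show ?case using elim by (simp add: diff_divide_distrib)
    qed
    show "\<forall>\<^sub>F N in sequentially. real (N div c) / real N \<le> 1 / real c"
      using eventually_gt_at_top[of 0]
    proof eventually_elim
      case (elim N)
      have "real (N div c) / real N \<le> (real N / real c) / real N"
        by (intro divide_right_mono of_nat_div_le_of_nat) simp
      then show ?case using elim by simp
    qed
  qed simp
  \<comment> \<open>The logarithm is slowly varying: \<open>ln (N div c)\<close> is
    \<open>ln N\<close> plus the logarithm of a ratio that converges to \<open>1 / c\<close>, and
    this bounded correction vanishes relative to \<open>ln N\<close>.\<close>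
  have "(\<lambda>N. 1 + ln (real (N div c) / real N) / ln (real N)) \<longlonglongrightarrow> 1 + 0"
    using assms ratio
    by (intro tendsto_add tendsto_const real_tendsto_divide_at_top[OF tendsto_ln]) (auto, real_asymp)
  moreover have "\<forall>\<^sub>F N in sequentially.
      1 + ln (real (N div c) / real N) / ln (real N) = ln (real (N div c)) / ln (real N)"
    using big eventually_ge_at_top[of 2]
    by eventually_elim (simp add: ln_div field_simps)
  ultimately have "(\<lambda>N. ln (real (N div c)) / ln (real N)) \<longlonglongrightarrow> 1"
    by (simp add: tendsto_cong)
  then have "(\<lambda>N. (real (N div c) / real N) powr a * (ln (real (N div c)) / ln (real N)) powr b)
      \<longlonglongrightarrow> (1 / real c) powr a * 1 powr b"
    using ratio assms by (intro tendsto_mult tendsto_powr tendsto_const) auto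
  moreover have "\<forall>\<^sub>F N in sequentially.
      (real (N div c) / real N) powr a * (ln (real (N div c)) / ln (real N)) powr b =
      power_log a b (N div c) / power_log a b N"
    using big eventually_ge_at_top[of 2] by eventually_elim (simp add: powr_divide)
  moreover have "(1 / real c) powr a = real c powr (- a)"
    using assms by (simp add: powr_divide powr_minus_divide)
  ultimately show ?thesis by (simp add: tendsto_cong)
qed

text \<open>This is monotonicity of \<open>power_log\<close> in the variable
  \<open>u = ln N\<close>. The logarithm of the function is \<open>e * u + b * ln u\<close>, with
  derivative \<open>e + b / u\<close>, which is nonnegative as soon as
  \<open>- b \<le> e * u\<close>. For negative \<open>b\<close> the inequality
  \<open>ln v - ln u \<le> (v - u) / u\<close> replaces the derivative.\<close>

lemma exp_powr_mono:
  fixes b e u v :: real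
  assumes "0 < u" "u \<le> v" "0 \<le> e" "- b \<le> e * u"
  shows "exp (e * u) * u powr b \<le> exp (e * v) * v powr b"
proof -
  have "e * u + b * ln u \<le> e * v + b * ln v"
  proof (cases "b \<ge> 0")
    case True
    then show ?thesis using assms by (intro add_mono mult_left_mono) auto
  next
    case False
    have "ln v - ln u \<le> (v - u) / u" using assms by (intro ln_diff_le) auto
    then have "- b * (ln v - ln u) \<le> - b * ((v - u) / u)"
      using False by (intro mult_left_mono) auto
    also have "\<dots> = (- b / u) * (v - u)" by simp
    also have "\<dots> \<le> e * (v - u)"
      using assms by (intro mult_right_mono) (auto simp: field_simps)
    finally show ?thesis by (simp add: algebra_simps)
  qed
  then have "exp (e * u + b * ln u) \<le> exp (e * v + b * ln v)" by simp
  then show ?thesis using assms by (simp add: exp_add powr_def)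
qed

lemma eventually_power_log_mono:
  assumes "e > 0 \<or> (e = 0 \<and> b \<ge> 0)"
  shows "\<exists>N\<^sub>0. \<forall>M\<ge>N\<^sub>0. \<forall>N\<ge>M. power_log e b M \<le> power_log e b N"
proof -
  have "\<forall>\<^sub>F N::nat in sequentially. - b \<le> e * ln (real N)"
  proof (cases "e > 0")
    case True
    then show ?thesis by real_asymp
  next
    case False
    then show ?thesis using assms by auto
  qed
  then obtain N\<^sub>0 where N\<^sub>0: "\<And>N. N \<ge> N\<^sub>0 \<Longrightarrow> - b \<le> e * ln (real N)"
    by (auto simp: eventually_at_top_linorder)
  \<comment> \<open>The 2 in the threshold ensures \<open>ln M > 0\<close>, as
    \<open>exp_powr_mono\<close> requires.\<close>
  have "power_log e b M \<le> power_log e b N" if "M \<ge> max N\<^sub>0 2" "N \<ge> M" for M N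
    using exp_powr_mono[of "ln (real M)" "ln (real N)" e b] N\<^sub>0[of M] that assms
    by (auto simp: powr_def)
  then show ?thesis by blast
qed

section \<open>Sequences asymptotic to a power-log function, and passage to the limit in the
  expansion\<close>

locale power_log_asymptotics =
  fixes S :: "nat \<Rightarrow> real" and F a b :: real
  assumes F_pos: "F > 0"
    and lim_1: "(\<lambda>N. S N / (F * power_log a b N)) \<longlonglongrightarrow> 1"
begin

lemma eventually_bounds:
  "\<forall>\<^sub>F N in sequentially. F / 2 * power_log a b N \<le> S N \<and> S N \<le> 2 * F * power_log a b N"
proof -
  have "\<forall>\<^sub>F N in sequentially. 1 / 2 < S N / (F * power_log a b N)"
    and "\<forall>\<^sub>F N in sequentially. S N / (F * power_log a b N) < 2"
    using order_tendstoD(1)[OF lim_1, of "1 / 2"] order_tendstoD(2)[OF lim_1, of 2] by simp_all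
  with eventually_ge_at_top[of 2] show ?thesis
  proof eventually_elim
    case (elim N)
    have "F * power_log a b N > 0" using F_pos power_log_pos[of N a b] elim by simp
    with elim(2,3) show ?case by (simp add: field_simps)
  qed
qed

lemma eventually_pos: "\<forall>\<^sub>F N in sequentially. S N > 0"
  using eventually_bounds eventually_ge_at_top[of 2]
proof eventually_elim
  case (elim N)
  have "F / 2 * power_log a b N > 0" using F_pos power_log_pos[of N a b] elim by simp
  with elim(1) show ?case by linarith
qed

lemma regularly_varying:
  assumes "c > 0"
  shows "(\<lambda>N. S (N div c) / S N) \<longlonglongrightarrow> real c powr (- a)"
proof -
  let ?g = "power_log a b"
  note div = filterlim_div_const[OF assms]
  have "(\<lambda>N. S (N div c) / (F * ?g (N div c)) / (S N / (F * ?g N)) * (?g (N div c) / ?g N))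
      \<longlonglongrightarrow> 1 / 1 * real c powr (- a)"
    by (intro tendsto_mult tendsto_divide lim_1 power_log_regularly_varying
        filterlim_compose[OF lim_1 div] assms) simp
  moreover have "\<forall>\<^sub>F N in sequentially. N div c \<ge> 2"
    using div by (simp add: filterlim_at_top)
  then have "\<forall>\<^sub>F N in sequentially.
      S (N div c) / (F * ?g (N div c)) / (S N / (F * ?g N)) * (?g (N div c) / ?g N) =
      S (N div c) / S N"
    using eventually_ge_at_top[of 2]
  proof eventually_elim
    case (elim N)
    then show ?case
      using power_log_pos[of N a b] power_log_pos[of "N div c" a b] F_pos
      by (simp add: field_simps)
  qed
  ultimately show ?thesis by (simp add: tendsto_cong)
qed

text \<open>Here \<open>S\<close> stands for the summatory function of \<open>f\<close> itself and
  \<open>T\<close> for the one with argument \<open>q * k\<close>. With \<open>c = p ^ r\<close>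
  this is the limit of the \<open>r\<close>-th term of the expansion, apart from its
  coefficient.\<close>

lemma proportional_div_tendsto:
  assumes "(\<lambda>N. T N / S N) \<longlonglongrightarrow> R" "c > 0"
  shows "(\<lambda>N. T (N div c) / S N) \<longlonglongrightarrow> R * real c powr (- a)"
proof -
  note div = filterlim_div_const[OF assms(2)]
  have "(\<lambda>N. T (N div c) / S (N div c) * (S (N div c) / S N)) \<longlonglongrightarrow> R * real c powr (- a)"
    by (intro tendsto_mult filterlim_compose[OF assms(1) div] regularly_varying assms)
  moreover have "\<forall>\<^sub>F N in sequentially. S (N div c) > 0"
    using eventually_compose_filterlim[OF eventually_pos div] .
  then have "\<forall>\<^sub>F N in sequentially.
      T (N div c) / S (N div c) * (S (N div c) / S N) = T (N div c) / S N"
    by eventually_elim simp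
  ultimately show ?thesis by (rule Lim_transform_eventually)
qed

text \<open>A bound of Potter type, uniform in all \<open>M\<close> from 1 to \<open>N\<close>.
  Write \<open>power_log a b\<close> as \<open>?h N * N powr \<delta>\<close>, where
  \<open>?h\<close> is eventually nondecreasing: for \<open>\<delta> < a\<close> a positive power of
  \<open>N\<close> outweighs any power of the logarithm, and for \<open>\<delta> = a\<close> the
  condition \<open>b \<ge> 0\<close> suffices. Replacing \<open>?h M\<close> by \<open>?h N\<close>
  leaves exactly the factor \<open>(M / N) powr \<delta>\<close>.\<close>

lemma proportional_bound:
  assumes T: "(\<lambda>N. T N / S N) \<longlonglongrightarrow> R"
    and \<delta>: "0 \<le> \<delta>" "\<delta> < a \<or> (\<delta> = a \<and> b \<ge> 0)"
  obtains C N\<^sub>0 where "C \<ge> 0" "N\<^sub>0 > 0"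
    and "\<And>M N. N \<ge> N\<^sub>0 \<Longrightarrow> 1 \<le> M \<Longrightarrow> M \<le> N \<Longrightarrow> \<bar>T M\<bar> \<le> C * (real M / real N) powr \<delta> * S N"
proof -
  let ?h = "power_log (a - \<delta>) b"
  obtain N\<^sub>1 where mono: "\<And>M N. N\<^sub>1 \<le> M \<Longrightarrow> M \<le> N \<Longrightarrow> ?h M \<le> ?h N"
    using eventually_power_log_mono[of "a - \<delta>" b] \<delta> by (metis diff_gt_0_iff_gt diff_self)
  obtain B where B: "B > 0" "\<And>N. \<bar>T N / S N\<bar> \<le> B"
    using convergent_imp_Bseq[OF convergentI[OF T]] by (auto simp: Bseq_def)
  obtain N\<^sub>2 where N\<^sub>2: "\<And>N. N \<ge> N\<^sub>2 \<Longrightarrow>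
      F / 2 * power_log a b N \<le> S N \<and> S N \<le> 2 * F * power_log a b N \<and> S N > 0"
    using eventually_conj[OF eventually_bounds eventually_pos]
    by (auto simp: eventually_at_top_linorder)
  define N\<^sub>0 where "N\<^sub>0 = max 2 (max N\<^sub>1 N\<^sub>2)"
  define D where "D = (\<Sum>M<N\<^sub>0. \<bar>T M\<bar>)"
  \<comment> \<open>The first summand serves \<open>M \<ge> N\<^sub>0\<close>, through
    \<open>\<bar>T M\<bar> \<le> B * S M\<close> and the upper bound on \<open>S M\<close>. The
    second makes \<open>E * ?h N\<^sub>0\<close> at least \<open>D\<close>, which covers the
    finitely many smaller \<open>M\<close>.\<close>
  define E where "E = 2 * B * F + D / ?h N\<^sub>0"
  have h_pos: "?h N > 0" if "N \<ge> N\<^sub>0" for N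
    using that by (intro power_log_pos) (simp add: N\<^sub>0_def)
  have D: "D \<ge> 0" by (simp add: D_def sum_nonneg)
  have E: "E \<ge> 2 * B * F" "E \<ge> D / ?h N\<^sub>0" "E \<ge> 0"
    using D h_pos[of N\<^sub>0] B F_pos by (auto simp: E_def)
  have split: "power_log a b N = ?h N * real N powr \<delta>" for N
  proof -
    have *: "real N powr a = real N powr (a - \<delta>) * real N powr \<delta>" by (simp flip: powr_add)
    show ?thesis unfolding * by (simp only: mult_ac)
  qed
  have key: "\<bar>T M\<bar> \<le> 2 * E / F * (real M / real N) powr \<delta> * S N"
    if N: "N \<ge> N\<^sub>0" and M: "1 \<le> M" "M \<le> N" for M N
  proof -
    have *: "\<bar>T M\<bar> \<le> E * ?h N * real M powr \<delta>"
    proof (cases "M \<ge> N\<^sub>0")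
      case True
      then have "S M \<le> 2 * F * power_log a b M" "S M > 0"
        using N\<^sub>2[of M] by (auto simp: N\<^sub>0_def)
      have "\<bar>T M\<bar> \<le> B * S M" using B(2)[of M] \<open>S M > 0\<close> by (simp add: field_simps)
      also have "\<dots> \<le> B * (2 * F * power_log a b M)"
        using B(1) \<open>S M \<le> _\<close> by (intro mult_left_mono) auto
      also have "\<dots> = 2 * B * F * ?h M * real M powr \<delta>" by (simp only: split mult_ac)
      also have "\<dots> \<le> E * ?h N * real M powr \<delta>"
      proof (rule mult_right_mono)
        have "?h M \<le> ?h N" using mono[of M N] True M by (simp add: N\<^sub>0_def)
        then show "2 * B * F * ?h M \<le> E * ?h N"
          using E h_pos[OF True] by (intro mult_mono[OF E(1)]) linarith+
      qed simp
      finally show ?thesis .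
    next
      case False
      \<comment> \<open>The asymptotics say nothing about small \<open>M\<close>. Instead
        \<open>D\<close> bounds \<open>T M\<close>, while \<open>?h N \<ge> ?h N\<^sub>0\<close>
        and, since \<open>\<delta> \<ge> 0\<close>, \<open>M powr \<delta> \<ge> 1\<close>.\<close>
      have "\<bar>T M\<bar> \<le> D" unfolding D_def using False by (intro member_le_sum) auto
      also have "D = D / ?h N\<^sub>0 * ?h N\<^sub>0 * 1"
        using h_pos[of N\<^sub>0] by (metis order.refl less_irrefl nonzero_divide_eq_eq mult.right_neutral)
      also have "\<dots> \<le> E * ?h N * real M powr \<delta>"
      proof (rule mult_mono)
        have "?h N\<^sub>0 \<le> ?h N" using mono[of N\<^sub>0 N] N by (simp add: N\<^sub>0_def)
        then show "D / ?h N\<^sub>0 * ?h N\<^sub>0 \<le> E * ?h N"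
          using E h_pos[of N\<^sub>0] by (intro mult_mono[OF E(2)]) linarith+
        show "1 \<le> real M powr \<delta>" using M \<delta> by (intro ge_one_powr_ge_zero) auto
        show "0 \<le> E * ?h N" by (rule mult_nonneg_nonneg[OF E(3) less_imp_le[OF h_pos[OF N]]])
      qed simp
      finally show ?thesis .
    qed
    \<comment> \<open>The lower bound on \<open>S N\<close> turns the model function back into
      \<open>S N\<close>, at the cost of the factor \<open>2 / F\<close>.\<close>
    have "?h N * real N powr \<delta> \<le> 2 / F * S N"
      using N\<^sub>2[of N] N F_pos unfolding split[symmetric] by (simp add: N\<^sub>0_def field_simps)
    have N_pos: "real N > 0" using N by (simp add: N\<^sub>0_def)
    have "E * ?h N * real M powr \<delta> = E * (real M / real N) powr \<delta> * (?h N * real N powr \<delta>)"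
      using N_pos by (simp add: powr_divide)
    also have "\<dots> \<le> E * (real M / real N) powr \<delta> * (2 / F * S N)"
      using E \<open>?h N * _ \<le> _\<close> by (intro mult_left_mono) auto
    finally show ?thesis using * by (simp add: mult_ac)
  qed
  show ?thesis
    by (rule that[of "2 * E / F" N\<^sub>0]) (use key E F_pos in \<open>auto simp: N\<^sub>0_def\<close>)
qed

text \<open>By \<open>proportional_bound\<close> with \<open>M = N div p ^ r\<close>, the quotient
  \<open>T M / S N\<close> is at most a constant times \<open>p powr (- \<delta> * r)\<close>.
  Against the growth of \<open>L\<close> this leaves a geometric majorant of ratio
  \<open>p powr (\<gamma> - \<delta>) < 1\<close>, independent of \<open>N\<close>, as Tannery's
  theorem demands.\<close>

lemma sum_div_powers_tendsto:
  fixes L :: "nat \<Rightarrow> real"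
  assumes T: "(\<lambda>N. T N / S N) \<longlonglongrightarrow> R" and T0: "T 0 = 0"
    and \<delta>: "0 \<le> \<delta>" "\<delta> < a \<or> (\<delta> = a \<and> b \<ge> 0)" "\<gamma> < \<delta>"
    and p: "p > 1"
    and L: "\<And>r. r \<ge> r\<^sub>0 \<Longrightarrow> \<bar>L r\<bar> \<le> K * real p powr (\<gamma> * real r)"
  shows "(\<lambda>N. (\<Sum>r\<le>N. L r * T (N div p ^ r)) / S N)
           \<longlonglongrightarrow> (\<Sum>r. L r * (R * real p powr (- (a * real r))))"
proof -
  obtain C N\<^sub>0 where C: "C \<ge> 0" "N\<^sub>0 > 0"
    and bound: "\<And>M N. N \<ge> N\<^sub>0 \<Longrightarrow> 1 \<le> M \<Longrightarrow> M \<le> N \<Longrightarrow>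
      \<bar>T M\<bar> \<le> C * (real M / real N) powr \<delta> * S N"
    using proportional_bound[OF T \<delta>(1,2)] by blast
  obtain N\<^sub>1 where N\<^sub>1: "\<And>N. N \<ge> N\<^sub>1 \<Longrightarrow> S N > 0"
    using eventually_pos by (auto simp: eventually_at_top_linorder)
  let ?t = "\<lambda>r N. L r * (T (N div p ^ r) / S N)"
  let ?M = "\<lambda>r. K * C * (real p powr (\<gamma> - \<delta>)) ^ r"
  have p_pow: "real (p ^ r) powr x = real p powr (x * real r)" for r x
    using p by (simp add: powr_realpow[symmetric] powr_powr mult.commute)
  have lim: "?t r \<longlonglongrightarrow> L r * (R * real p powr (- (a * real r)))" for r
    using proportional_div_tendsto[OF T, of "p ^ r"] p unfolding p_pow
    by (intro tendsto_mult_left) simp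
  have dom: "norm (?t r N) \<le> ?M r" if r: "r \<ge> r\<^sub>0" and N: "N \<ge> max N\<^sub>0 N\<^sub>1" for r N
  proof -
    have K: "0 \<le> K * real p powr (\<gamma> * real r)" using L[OF r] by linarith
    have "S N > 0" using N\<^sub>1 N by simp
    have "\<bar>T (N div p ^ r)\<bar> \<le> C * real p powr (- \<delta> * real r) * S N"
    \<comment> \<open>\<open>proportional_bound\<close> starts at \<open>M = 1\<close>; for quotient
      0 the value \<open>T 0 = 0\<close> takes over.\<close>
    proof (cases "N div p ^ r = 0")
      case True
      then show ?thesis using T0 C \<open>S N > 0\<close> by simp
    next
      case False
      have "real (N div p ^ r) / real N \<le> 1 / real (p ^ r)"
        using of_nat_div_le_of_nat[of N "p ^ r", where ?'a = real] N C p
        by (simp add: field_simps)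
      then have "(real (N div p ^ r) / real N) powr \<delta> \<le> (1 / real (p ^ r)) powr \<delta>"
        using \<delta> by (intro powr_mono2) auto
      also have "\<dots> = real p powr (- \<delta> * real r)"
        using p_pow[of r \<delta>] by (simp add: powr_divide powr_minus_divide)
      finally have "C * (real (N div p ^ r) / real N) powr \<delta> * S N
          \<le> C * real p powr (- \<delta> * real r) * S N"
        using C \<open>S N > 0\<close> by (intro mult_right_mono mult_left_mono) auto
      then show ?thesis using bound[of N "N div p ^ r"] False N by force
    qed
    then have "\<bar>T (N div p ^ r) / S N\<bar> \<le> C * real p powr (- \<delta> * real r)"
      using \<open>S N > 0\<close> by (simp add: field_simps)
    then have "norm (?t r N) \<le> K * real p powr (\<gamma> * real r) * (C * real p powr (- \<delta> * real r))"
      unfolding real_norm_def abs_mult using L[OF r] K by (intro mult_mono) auto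
    also have "\<dots> = K * C * (real p powr (\<gamma> * real r) * real p powr (- \<delta> * real r))"
      by (simp only: mult_ac)
    also have "real p powr (\<gamma> * real r) * real p powr (- \<delta> * real r) =
        (real p powr (\<gamma> - \<delta>)) ^ r"
      using p by (simp add: powr_realpow[symmetric] powr_powr powr_add[symmetric] algebra_simps)
    finally show ?thesis .
  qed
  have "summable ?M"
    using p \<delta> by (intro summable_mult summable_geometric) (simp add: powr_less_one)
  moreover have "\<forall>\<^sub>F (r, N) in sequentially \<times>\<^sub>F sequentially. norm (?t r N) \<le> ?M r"
    \<comment> \<open>Domination holds only for large \<open>r\<close> and large \<open>N\<close>;
      the product filter asks for no more, so the terms below \<open>r\<^sub>0\<close> need no
      bound.\<close>
    unfolding eventually_prod_sequentially
    using dom by (intro exI[of _ "max r\<^sub>0 (max N\<^sub>0 N\<^sub>1)"]) auto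
  ultimately have "(\<lambda>N. \<Sum>r. ?t r N) \<longlonglongrightarrow> (\<Sum>r. L r * (R * real p powr (- (a * real r))))"
    using tannerys_theorem[OF lim, where M = ?M] by simp
  \<comment> \<open>For fixed \<open>N\<close> the series is a finite sum: \<open>N < p ^ r\<close>
    for every \<open>r > N\<close>, and \<open>T 0 = 0\<close>.\<close>
  moreover have "(\<Sum>r. ?t r N) = (\<Sum>r\<le>N. L r * T (N div p ^ r)) / S N" for N
  proof -
    have "N div p ^ r = 0" if "r > N" for r
    proof -
      have "r < p ^ r" using p by (simp add: power_gt_expt)
      then show ?thesis using that by simp
    qed
    then have "(\<Sum>r. ?t r N) = (\<Sum>r\<le>N. ?t r N)"
      using T0 by (intro suminf_finite) auto
    then show ?thesis by (simp add: sum_divide_distrib)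
  qed
  ultimately show ?thesis by simp
qed

end

section \<open>Adjoining one prime power, and induction on the number of primes\<close>

lemma summable_of_geometric_bound:
  fixes L :: "nat \<Rightarrow> real"
  assumes "p > 1" "\<gamma> < a"
    and L: "\<And>r. r \<ge> r\<^sub>0 \<Longrightarrow> \<bar>L r\<bar> \<le> K * real p powr (\<gamma> * real r)"
  shows "summable (\<lambda>r. L r / real p powr (a * real r))"
proof (rule summable_comparison_test_ev)
  show "summable (\<lambda>r. K * (real p powr (\<gamma> - a)) ^ r)"
    using assms by (intro summable_mult summable_geometric) (simp add: powr_less_one)
  show "\<forall>\<^sub>F r in sequentially.
      norm (L r / real p powr (a * real r)) \<le> K * (real p powr (\<gamma> - a)) ^ r"
    using eventually_ge_at_top[of r\<^sub>0]
  proof eventually_elim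
    case (elim r)
    have "(real p powr (\<gamma> - a)) ^ r = real p powr (\<gamma> * real r) / real p powr (a * real r)"
      using assms(1)
      by (simp add: powr_realpow[symmetric] powr_powr powr_diff[symmetric] algebra_simps)
    then show ?case using L[OF elim] by (simp add: divide_right_mono)
  qed
qed

lemma renorm_ratio_prime_power_tendsto:
  assumes "power_log_asymptotics (\<lambda>N. summatory f N 1) F a b"
    and f: "multiplicative f" and p: "prime p" and q: "q > 0" "coprime q p"
    and R: "renorm_ratio f q \<longlonglongrightarrow> R"
    and a: "a > 0 \<or> (a = 0 \<and> b \<ge> 0)" and \<gamma>: "\<gamma> < a"
    and L: "\<And>r. r \<ge> r\<^sub>0 \<Longrightarrow> \<bar>char_fun f p m r\<bar> \<le> K * real p powr (\<gamma> * real r)"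
  shows "renorm_ratio f (q * p ^ m)
           \<longlonglongrightarrow> R * (\<Sum>r. char_fun f p m r / real p powr (a * real r))"
proof -
  interpret power_log_asymptotics "\<lambda>N. summatory f N 1" F a b by fact
  have p1: "p > 1" using p by (rule prime_gt_1_nat)
  \<comment> \<open>For \<open>a > 0\<close> take the midpoint between \<open>max \<gamma> 0\<close>
    and \<open>a\<close>, which is nonnegative, above \<open>\<gamma>\<close> and strictly below
    \<open>a\<close>. For \<open>a = 0\<close> nothing nonnegative lies below \<open>a\<close>, so
    \<open>\<delta> = a = 0\<close>, which is admissible because then \<open>b \<ge> 0\<close> and
    \<open>\<gamma> < 0\<close>.\<close>
  obtain \<delta> where \<delta>: "0 \<le> \<delta>" "\<delta> < a \<or> (\<delta> = a \<and> b \<ge> 0)" "\<gamma> < \<delta>"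
  proof (cases "a > 0")
    case True
    then show ?thesis using \<gamma> that[of "(max \<gamma> 0 + a) / 2"] by (auto simp: max_def)
  next
    case False
    then show ?thesis using \<gamma> a that[of 0] by auto
  qed
  have "(\<lambda>N. (\<Sum>r\<le>N. char_fun f p m r * summatory f (N div p ^ r) q) / summatory f N 1)
      \<longlonglongrightarrow> (\<Sum>r. char_fun f p m r * (R * real p powr (- (a * real r))))"
    by (rule sum_div_powers_tendsto[OF _ _ \<delta> p1 L])
      (use R in \<open>auto simp: renorm_ratio_def[abs_def] summatory_def\<close>)
  also have "(\<lambda>r. char_fun f p m r * (R * real p powr (- (a * real r)))) =
      (\<lambda>r. R * (char_fun f p m r / real p powr (a * real r)))"
    by (simp add: powr_minus_divide fun_eq_iff)
  also have "suminf \<dots> = R * (\<Sum>r. char_fun f p m r / real p powr (a * real r))"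
    using summable_of_geometric_bound[OF p1 \<gamma> L] by (rule suminf_mult)
  finally show ?thesis
    by (simp add: renorm_ratio_def[abs_def] summatory_prime_power[OF f p q])
qed

theorem theorem3:
  fixes f :: "nat \<Rightarrow> real"
    and n :: nat and p m :: "nat \<Rightarrow> nat"
    and a\<^sub>1 b\<^sub>1 a\<^sub>2 b\<^sub>2 K \<gamma> :: real and r_star :: nat
  assumes "n \<ge> 1"
    and "\<forall>i\<in>{1..n}. prime (p i)"
    and "inj_on p {1..n}"
    and "multiplicative f"
    and "f \<in> universality_class
               (\<lambda>N. real N powr a\<^sub>1 * ln (real N) powr b\<^sub>1)
               (\<lambda>N. real N powr (- a\<^sub>2) * ln (real N) powr (- b\<^sub>2))"
    and "a\<^sub>1 > 0 \<or> (a\<^sub>1 = 0 \<and> b\<^sub>1 \<ge> 0)"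
    and "a\<^sub>2 > 0 \<or> (a\<^sub>2 = 0 \<and> b\<^sub>2 > 0)"
    and "K > 0" and "\<gamma> < a\<^sub>1"
    and "\<forall>i\<in>{1..n}. \<forall>r\<ge>r_star.
           \<bar>char_fun f (p i) (m i) r\<bar> \<le> K * real (p i) powr (\<gamma> * real r)"
  shows "convergent (renorm_ratio f (\<Prod>i=1..n. p i ^ m i)) \<and>
         (\<forall>i\<in>{1..n}. summable
            (\<lambda>r. char_fun f (p i) (m i) r / real (p i) powr (a\<^sub>1 * real r))) \<and>
         renorm_limit f (\<Prod>i=1..n. p i ^ m i) =
           (\<Prod>i=1..n. \<Sum>r. char_fun f (p i) (m i) r / real (p i) powr (a\<^sub>1 * real r))"
proof -
  obtain F where "power_log_asymptotics (\<lambda>N. summatory f N 1) F a\<^sub>1 b\<^sub>1"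
    using assms(5) by (auto simp: universality_class_def power_log_asymptotics_def)
  then interpret power_log_asymptotics "\<lambda>N. summatory f N 1" F a\<^sub>1 b\<^sub>1 .
  let ?\<Sigma> = "\<lambda>i. \<Sum>r. char_fun f (p i) (m i) r / real (p i) powr (a\<^sub>1 * real r)"
  have prime: "prime (p i)" if "i \<in> {1..n}" for i using assms(2) that by blast
  have L: "\<bar>char_fun f (p i) (m i) r\<bar> \<le> K * real (p i) powr (\<gamma> * real r)"
    if "i \<in> {1..n}" "r \<ge> r_star" for i r using assms(10) that by blast
  \<comment> \<open>Induction on \<open>k\<close>: the product over the first \<open>k\<close>
    primes plays the part of \<open>q\<close>, and it is coprime to the next prime because
    \<open>p\<close> is injective on the index set.\<close>
  have lim: "renorm_ratio f (\<Prod>i=1..k. p i ^ m i) \<longlonglongrightarrow> (\<Prod>i=1..k. ?\<Sigma> i)" if "k \<le> n" for k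
    using that
  proof (induction k)
    case 0
    \<comment> \<open>For the empty product the ratio is \<open>S N / S N\<close>; it equals 1 only
      where \<open>S N\<close> is nonzero, since \<open>0 / 0 = 0\<close>.\<close>
    have "\<forall>\<^sub>F N in sequentially. 1 = renorm_ratio f 1 N"
      using eventually_pos by eventually_elim (simp add: renorm_ratio_def)
    then have "renorm_ratio f 1 \<longlonglongrightarrow> 1" by (rule tendsto_eventually[OF eventually_mono]) simp
    then show ?case by simp
  next
    case (Suc k)
    then have k: "Suc k \<in> {1..n}" by simp
    have "coprime (p i) (p (Suc k))" if "i \<in> {1..k}" for i
    proof (rule primes_coprime)
      show "p i \<noteq> p (Suc k)"
        using that k inj_onD[OF assms(3), of i "Suc k"] by auto
    qed (use that k prime in auto)
    then have "coprime (\<Prod>i=1..k. p i ^ m i) (p (Suc k))"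
      by (intro prod_coprime_left) simp
    moreover have "(\<Prod>i=1..k. p i ^ m i) > 0"
      using Suc.prems prime by (intro prod_pos) (auto simp: prime_gt_0_nat)
    ultimately show ?case
      using renorm_ratio_prime_power_tendsto[OF power_log_asymptotics_axioms assms(4) prime[OF k]
          _ _ Suc.IH assms(6,9) L[OF k]] Suc.prems by simp
  qed
  \<comment> \<open>This guarantees that each \<open>suminf\<close> in the formula is the sum of a
    convergent series and not an unspecified value.\<close>
  have "summable (\<lambda>r. char_fun f (p i) (m i) r / real (p i) powr (a\<^sub>1 * real r))"
    if "i \<in> {1..n}" for i
    using prime_gt_1_nat[OF prime[OF that]] assms(9) L[OF that] by (rule summable_of_geometric_bound)
  then show ?thesis
    using lim[of n] by (auto simp: convergent_def renorm_limit_def limI)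
qed

end
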